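(* Let Assumption A (see context) hold and let $\mu_n$, $\mu$ and $M_0$ be as defined in the context. Let $y\in M_0$. If the measures $U\mapsto\int_U\rho(x,y)\,d\mu_{X_n}(x)$ on $(F,\mathcal F)$ are uniformly bounded (in $n$), and equicontinuous at zero in the sense that for every decreasing sequence $\{U_i\}\subset\mathcal F$ with empty intersection $$\lim_{i\to\infty}\sup_n\int_{U_i}\rho(x,y)\,d\mu_{X_n}(x)=0,$$ then the approximated posterior distributions $\mu_n(\cdot,y)$ converge setwise (respectively, in variation) to the posterior distribution $\mu(\cdot,y)$ whenever the approximated prior distributions $\mu_{X_n}$ converge setwise (respectively, in variation) to the prior distribution $\mu_X$.
   Context: A Souslin space is a Hausdorff topological space that is the image of a complete separable metric space under a continuous mapping. For a random variable $Z$, $\mu_Z=P\circ Z^{-1}$; for $x\in F$, $\mu_{\varepsilon+L(x)}$ is the image measure of $\omega\mapsto\varepsilon(\omega)+L(x)$. Borel measures and their Lebesgue completions are denoted by the same symbol. Assumption A: (1) $F$ and $G$ are locally convex Souslin topological vector spaces with Borel $\sigma$-algebras $\mathcal F$ and $\mathcal G$. (2) $(\Omega,\Sigma,P)$ is a complete probability space, $X$ and $X_n$ ($n\in\mathbf N$) are $F$-valued random variables on $\Omega$ and $\varepsilon$ is a $G$-valued random variable on $\Omega$; $X$ and $\varepsilon$ are independent, and $X_n$ and $\varepsilon$ are independent for each $n$. (3) $L:F\to G$ is continuous; $Y=L(X)+\varepsilon$ and $Y_n=L(X_n)+\varepsilon$. (4) $\mu_{\varepsilon+L(x)}$ is absolutely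 continuous with respect to some $\sigma$-finite measure $\nu$ on $(G,\mathcal G)$ for any $x\in F$, and its density $\rho(x,y):=\frac{d\mu_{\varepsilon+L(x)}}{d\nu}(y)$ is a $\mu_Z\times\nu$-measurable function on $F\times G$ for $Z=X$ and $Z=X_n$, $n\in\mathbf N$. Definitions: $M_0=\{y\in G:0<\int\rho(x,y)\,d\mu_Z(x)<\infty\text{ for }Z=X\text{ and }Z=X_n,\ n\in\mathbf N\}$, and for $U\in\mathcal F$, $y\in M_0$, $$\mu_n(U,y)=\frac{\int 1_U(x)\rho(x,y)\,d\mu_{X_n}(x)}{\int\rho(x,y)\,d\mu_{X_n}(x)},\qquad \mu(U,y)=\frac{\int 1_U(x)\rho(x,y)\,d\mu_X(x)}{\int\rho(x,y)\,d\mu_X(x)}.$$ Measures $m_n$ on $(F,\mathcal F)$ converge setwise to $m$ if $m_n(U)\to m(U)$ for every $U\in\mathcal F$, and converge in variation to $m$ if $\sup_{U\in\mathcal F}|m_n(U)-m(U)|\to0$. *)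

theory Defs
  imports "HOL-Probability.Probability"
begin

section \<open>Locally convex Souslin spaces\<close>

text \<open>
  A topological vector space in which every neighbourhood of the origin contains a convex
  open one. Convexity is written out because the constant \<open>convex\<close> cannot be used inside a class
  specification; see \<open>locally_convex_convex\<close>.
\<close>

class locally_convex_space = real_vector + topological_ab_group_add +
  assumes tendsto_scaleR_Pair:
      "LIM p (nhds c \<times>\<^sub>F nhds x). fst p *\<^sub>R snd p :> nhds (c *\<^sub>R x)"
    and locally_convex: "open U \<Longrightarrow> 0 \<in> U \<Longrightarrow>
      \<exists>V. open V \<and> 0 \<in> V \<and> V \<subseteq> U \<and>
        (\<forall>a\<in>V. \<forall>b\<in>V. \<forall>s\<ge>0. \<forall>t\<ge>0. s + t = 1 \<longrightarrow> s *\<^sub>R a + t *\<^sub>R b \<in> V)"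

lemma locally_convex_convex:
  fixes U :: "'a::locally_convex_space set"
  assumes "open U" "0 \<in> U"
  shows "\<exists>V. open V \<and> 0 \<in> V \<and> V \<subseteq> U \<and> convex V"
  using locally_convex[OF assms] unfolding convex_def by blast

text \<open>
  A complete separable metric space has at most the cardinality of the continuum, so it is no
  restriction to let its points be real numbers (the metric is arbitrary, unrelated to the usual
  one). The lemma \<open>souslin_spaceI\<close> proves this: any type may be used for the points.
\<close>

definition souslin_space :: "'a topology \<Rightarrow> bool" where
  "souslin_space X \<longleftrightarrow> Hausdorff_space X \<and>
     (\<exists>(m :: real metric) f. mcomplete_of m \<and> separable_space (mtopology_of m) \<and>
        continuous_map (mtopology_of m) X f \<and> f ` mspace m = topspace X)"

lemma souslin_spaceI:
  fixes m :: "'b metric" and X :: "'a topology"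
  assumes H: "Hausdorff_space X" and c: "mcomplete_of m" and s: "separable_space (mtopology_of m)"
    and f: "continuous_map (mtopology_of m) X f" "f ` mspace m = topspace X"
  shows "souslin_space X"
proof -
  interpret M: Metric_space "mspace m" "mdist m" by simp
  obtain C where C: "countable C" "C \<subseteq> mspace m" "mtopology_of m closure_of C = mspace m"
    using s by (auto simp: separable_space_def)
  obtain e :: "nat set \<Rightarrow> real" where e: "inj e"
    using nat_sets_eqpoll_reals by (auto simp: eqpoll_def bij_betw_def)
  define g where "g x = (\<lambda>p::'b\<times>rat. to_nat_on (C \<times> UNIV) p) ` {(q,r). q \<in> C \<and> mdist m x q < of_rat r}" for x
  have near: "\<exists>q\<in>C. mdist m x q < r" if "x \<in> mspace m" "r > 0" for x r
  proof -
    have "x \<in> M.mtopology closure_of C" using C(3) that by (simp add: mtopology_of_def)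
    then show ?thesis using that unfolding M.metric_closure_of by (auto simp: M.in_mball)
  qed
  have inj_g: "inj_on g (mspace m)"
  proof (rule inj_onI, rule ccontr)
    fix x y assume xy: "x \<in> mspace m" "y \<in> mspace m" "g x = g y" "x \<noteq> y"
    have cC: "countable (C \<times> (UNIV::rat set))" using C by simp
    have eq: "{(q,r). q \<in> C \<and> mdist m x q < of_rat r} = {(q,r::rat). q \<in> C \<and> mdist m y q < of_rat r}"
      using xy(3) unfolding g_def
      by (subst (asm) inj_on_image_eq_iff[OF inj_on_to_nat_on[OF cC]]) auto
    have d: "mdist m x y > 0" using xy by simp
    then obtain q where q: "q \<in> C" "mdist m x q < mdist m x y / 2" using near[OF xy(1), of "mdist m x y / 2"] by auto
    obtain r where r: "mdist m x q < of_rat r" "of_rat r < mdist m x y / 2"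
      using of_rat_dense[OF q(2)] by blast
    have "mdist m y q < of_rat r" using eq q(1) r(1) by auto
    moreover have "mdist m x y \<le> mdist m x q + mdist m q y"
      using q(1) C(2) xy M.triangle by blast
    ultimately show False using r by (simp add: mdist_commute)
  qed
  define h where "h = e \<circ> g"
  have inj_h: "inj_on h (mspace m)" unfolding h_def using inj_g e
    by (meson comp_inj_on inj_on_subset subset_UNIV)
  define k where "k = inv_into (mspace m) h"
  define N where "N = h ` mspace m"
  define d where "d a b = mdist m (k a) (k b)" for a b
  have kh: "k (h x) = x" if "x \<in> mspace m" for x using inj_h that by (simp add: k_def)
  have hk: "h (k a) = a" "k a \<in> mspace m" if "a \<in> N" for a
    using that by (auto simp: N_def kh)
  interpret N: Metric_space N d
    by unfold_locales (auto simp: d_def hk mdist_commute intro: M.triangle dest: hk(1))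
  interpret MN: Metric_space12 "mspace m" "mdist m" N d by unfold_locales
  have hom: "homeomorphic_map M.mtopology N.mtopology h"
    by (rule MN.isometry_imp_homeomorphic_map) (auto simp: N_def d_def kh)
  then obtain h' where h': "homeomorphic_maps M.mtopology N.mtopology h h'"
    by (auto simp: homeomorphic_map_maps)
  then have hs: "M.mtopology homeomorphic_space N.mtopology" by (auto simp: homeomorphic_space_def)
  have "completely_metrizable_space M.mtopology"
    unfolding completely_metrizable_space_def
    using c M.Metric_space_axioms by (intro exI[of _ "mspace m"] exI[of _ "mdist m"]) (simp add: mcomplete_of_def)
  then have "completely_metrizable_space N.mtopology"
    using hs homeomorphic_completely_metrizable_space by blast
  then obtain N' d' where N': "Metric_space N' d'" "Metric_space.mcomplete N' d'"
    "N.mtopology = Metric_space.mtopology N' d'"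
    unfolding completely_metrizable_space_def by blast
  interpret N': Metric_space N' d' by fact
  define m' where "m' = metric (N', d')"
  have top: "mtopology_of m' = N.mtopology" by (simp add: m'_def N'(3))
  have "separable_space (mtopology_of m')"
    unfolding top using s homeomorphic_separable_space[OF hs] by (simp add: mtopology_of_def)
  moreover have "mcomplete_of m'" using N' by (simp add: m'_def)
  moreover have "continuous_map (mtopology_of m') X (f \<circ> h')"
  proof (rule continuous_map_compose)
    show "continuous_map (mtopology_of m') M.mtopology h'"
      using h' unfolding top homeomorphic_maps_def by simp
    show "continuous_map M.mtopology X f"
      using f(1) by (simp add: mtopology_of_def)
  qed
  moreover have "(f \<circ> h') ` mspace m' = topspace X"
  proof -
    have "mspace m' = topspace N.mtopology" by (metis top topspace_mtopology_of)
    moreover have "h' ` topspace N.mtopology = mspace m"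
    proof -
      have "homeomorphic_map N.mtopology M.mtopology h'"
        using h' by (simp add: homeomorphic_maps_map)
      then show ?thesis using homeomorphic_imp_surjective_map M.topspace_mtopology by metis
    qed
    ultimately show ?thesis using f(2) by (simp only: image_comp[symmetric])
  qed
  ultimately show ?thesis
    unfolding souslin_space_def
    by (intro conjI H exI[of _ m'] exI[of _ "f \<circ> h'"])
qed

section \<open>Modes of convergence of set functions\<close>

definition converges_setwise ::
    "'a set set \<Rightarrow> (nat \<Rightarrow> 'a set \<Rightarrow> real) \<Rightarrow> ('a set \<Rightarrow> real) \<Rightarrow> bool" where
  "converges_setwise \<F> m m' \<longleftrightarrow> (\<forall>U\<in>\<F>. (\<lambda>n. m n U) \<longlonglongrightarrow> m' U)"

text \<open>The supremum is taken in \<open>ennreal\<close>, since on \<open>real\<close> it is meaningless for unbounded sets.\<close>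

definition converges_in_variation ::
    "'a set set \<Rightarrow> (nat \<Rightarrow> 'a set \<Rightarrow> real) \<Rightarrow> ('a set \<Rightarrow> real) \<Rightarrow> bool" where
  "converges_in_variation \<F> m m' \<longleftrightarrow> (\<lambda>n. SUP U\<in>\<F>. ennreal \<bar>m n U - m' U\<bar>) \<longlonglongrightarrow> 0"


section \<open>The statistical inverse problem\<close>

abbreviation law :: "'w measure \<Rightarrow> ('w \<Rightarrow> 'a::topological_space) \<Rightarrow> 'a measure" where
  "law P Z \<equiv> distr P borel Z"

text \<open>
  Densities take values in \<open>ennreal\<close>, as in the library. Only measurability with respect to
  completed measures is required, so integrals are taken over the completions (which agree with
  the original measures on Borel sets and Borel functions).
\<close>

definition is_density :: "'a::topological_space measure \<Rightarrow> 'a measure \<Rightarrow> ('a \<Rightarrow> ennreal) \<Rightarrow> bool" where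
  "is_density \<nu> m f \<longleftrightarrow> f \<in> borel_measurable (completion \<nu>) \<and>
     (\<forall>B\<in>sets borel. emeasure m B = (\<integral>\<^sup>+y. f y * indicator B y \<partial>completion \<nu>))"

text \<open>
  Independence of two random variables with possibly different value types, for which the
  library's \<open>indep_var\<close> cannot be used; on a common type the two notions agree.
\<close>

definition (in prob_space) independent ::
    "('a \<Rightarrow> 'b::topological_space) \<Rightarrow> ('a \<Rightarrow> 'c::topological_space) \<Rightarrow> bool" where
  "independent Z W \<longleftrightarrow>
     Z \<in> borel_measurable M \<and> W \<in> borel_measurable M \<and>
     indep_set {Z -` A \<inter> space M | A. A \<in> sets borel} {W -` B \<inter> space M | B. B \<in> sets borel}"

lemma (in prob_space) independent_iff_indep_var:
  "independent Z W \<longleftrightarrow> indep_var borel Z borel W"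
proof -
  have *: "sigma_sets (space M) {Z -` A \<inter> space M | A. A \<in> sets borel}
      = {Z -` A \<inter> space M | A. A \<in> sets borel}" for Z :: "'a \<Rightarrow> 'b"
    using sets_vimage_algebra[of "space M" Z borel] sets_vimage_algebra2[of Z "space M" borel]
    by simp
  show ?thesis
    unfolding independent_def indep_var_eq * by simp
qed

locale inverse_problem = prob_space P + complete_measure P
  for P :: "'w measure" +
  fixes X :: "'w \<Rightarrow> 'f::locally_convex_space"
    and Xn :: "nat \<Rightarrow> 'w \<Rightarrow> 'f"
    and \<epsilon> :: "'w \<Rightarrow> 'g::locally_convex_space"
    and L :: "'f \<Rightarrow> 'g"
    and Y :: "'w \<Rightarrow> 'g"
    and Yn :: "nat \<Rightarrow> 'w \<Rightarrow> 'g"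
    and \<nu> :: "'g measure"
    and \<rho> :: "'f \<Rightarrow> 'g \<Rightarrow> ennreal"
  assumes souslin_F: "souslin_space (euclidean :: 'f topology)"
    and souslin_G: "souslin_space (euclidean :: 'g topology)"
    and X_measurable: "X \<in> borel_measurable P"
    and Xn_measurable: "\<And>n. Xn n \<in> borel_measurable P"
    and noise_measurable: "\<epsilon> \<in> borel_measurable P"
    and indep_X: "independent X \<epsilon>"
    and indep_Xn: "\<And>n. independent (Xn n) \<epsilon>"
    and L_continuous: "continuous_on UNIV L"
    and Y_eq: "Y = (\<lambda>\<omega>. L (X \<omega>) + \<epsilon> \<omega>)"
    and Yn_eq: "\<And>n. Yn n = (\<lambda>\<omega>. L (Xn n \<omega>) + \<epsilon> \<omega>)"
    and sets_\<nu>: "sets \<nu> = sets borel"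
    and sigma_finite_\<nu>: "sigma_finite_measure \<nu>"
    and abs_cont: "\<And>x. absolutely_continuous \<nu> (law P (\<lambda>\<omega>. \<epsilon> \<omega> + L x))"
    and \<rho>_density: "\<And>x. is_density \<nu> (law P (\<lambda>\<omega>. \<epsilon> \<omega> + L x)) (\<rho> x)"
    and \<rho>_measurable: "\<And>Z. Z \<in> insert X (range Xn) \<Longrightarrow>
      (\<lambda>(x, y). \<rho> x y) \<in> borel_measurable (completion (law P Z \<Otimes>\<^sub>M \<nu>))"

definition unnormalized_posterior ::
    "'w measure \<Rightarrow> ('f \<Rightarrow> 'g \<Rightarrow> ennreal) \<Rightarrow> ('w \<Rightarrow> 'f::topological_space) \<Rightarrow> 'f set \<Rightarrow> 'g \<Rightarrow> ennreal" where
  "unnormalized_posterior P \<rho> Z U y = (\<integral>\<^sup>+x. indicator U x * \<rho> x y \<partial>completion (law P Z))"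

text \<open>
  Measurability of \<open>\<lambda>x. \<rho> x y\<close> is the tacit requirement that the integrals be defined;
  joint measurability gives it for almost every \<open>y\<close> only, and \<open>nn_integral\<close> is total.
\<close>

definition M0 ::
    "'w measure \<Rightarrow> ('w \<Rightarrow> 'f::topological_space) \<Rightarrow> (nat \<Rightarrow> 'w \<Rightarrow> 'f) \<Rightarrow> ('f \<Rightarrow> 'g \<Rightarrow> ennreal) \<Rightarrow> 'g set" where
  "M0 P X Xn \<rho> = {y. \<forall>Z\<in>insert X (range Xn).
     (\<lambda>x. \<rho> x y) \<in> borel_measurable (completion (law P Z)) \<and>
     0 < (\<integral>\<^sup>+x. \<rho> x y \<partial>completion (law P Z)) \<and> (\<integral>\<^sup>+x. \<rho> x y \<partial>completion (law P Z)) < \<infinity>}"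

definition posterior ::
    "'w measure \<Rightarrow> ('f \<Rightarrow> 'g \<Rightarrow> ennreal) \<Rightarrow> ('w \<Rightarrow> 'f::topological_space) \<Rightarrow> 'f set \<Rightarrow> 'g \<Rightarrow> real" where
  "posterior P \<rho> Z U y =
     enn2real (unnormalized_posterior P \<rho> Z U y / (\<integral>\<^sup>+x. \<rho> x y \<partial>completion (law P Z)))"

end

theory Submission
  imports Defs
begin

text \<open>
  For fixed \<open>y\<close> the density \<open>\<rho> x y\<close> agrees, almost everywhere for every prior, with one finite
  Borel function \<open>g\<close>. Equicontinuity, applied to the sets \<open>{x. k < g x}\<close>, makes \<open>g\<close> uniformly
  integrable for the approximating priors, so it may be truncated; the truncation is within a
  constant \<open>c\<close> of a combination of level sets, whose measures converge. Integrating over a sequence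
  of sets \<open>U n\<close> treats both modes of convergence at once: constant sequences give setwise
  convergence, arbitrary ones convergence in variation. The posterior is the quotient of two such
  integrals with a positive limit in the denominator.
\<close>

text \<open>
  The measures need not have a common completion, so the version is the supremum of Borel
  functions below \<open>f\<close>, one for each measure.
\<close>

lemma common_borel_version:
  fixes f :: "'a \<Rightarrow> ennreal" and N :: "nat \<Rightarrow> 'a measure"
  assumes sets: "\<And>n. sets (N n) = sets M"
    and f: "\<And>n. f \<in> borel_measurable (completion (N n))"
    and fin: "\<And>n. (\<integral>\<^sup>+x. f x \<partial>completion (N n)) < \<infinity>"
  obtains g :: "'a \<Rightarrow> real" where "g \<in> borel_measurable M" "\<And>x. 0 \<le> g x"
    "\<And>n. AE x in N n. f x = ennreal (g x)"
proof -
  have "\<exists>h. h \<in> borel_measurable (N n) \<and> h \<le> f \<and> (AE x in N n. f x = h x)" for n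
  proof -
    obtain h where h: "h \<in> borel_measurable (N n)" "AE x in N n. f x = h x"
      using completion_ex_borel_measurable[OF f] by blast
    from h(2) obtain A where A: "{x \<in> space (N n). f x \<noteq> h x} \<subseteq> A" "A \<in> null_sets (N n)"
      by (auto elim!: AE_E simp: null_sets_def)
    \<comment> \<open>Zeroing the version on a null set that contains every disagreement with
      \<open>f\<close> puts it below \<open>f\<close> everywhere, so the supremum over all the
      measures cannot exceed \<open>f\<close>.\<close>
    define h' where "h' x = (if x \<in> space (N n) - A then h x else 0)" for x
    have "h' \<in> borel_measurable (N n)"
      unfolding h'_def using h(1) A(2) by (intro measurable_If_set) auto
    moreover have "h' \<le> f" using A(1) by (auto simp: le_fun_def h'_def)
    moreover have "AE x in N n. f x = h' x"
      using AE_not_in[OF A(2)] AE_space h(2) by eventually_elim (auto simp: h'_def)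
    ultimately show ?thesis by blast
  qed
  then obtain h where h: "\<And>n. h n \<in> borel_measurable (N n)" "\<And>n. h n \<le> f"
    "\<And>n. AE x in N n. f x = h n x" by metis
  have hM: "\<And>n. h n \<in> borel_measurable M"
    using h(1) measurable_cong_sets[OF sets refl] by blast
  \<comment> \<open>\<open>enn2real\<close> sends infinity to 0; finiteness of the integrals makes
    this harmless almost everywhere for each \<open>N n\<close>.\<close>
  define g where "g x = enn2real (SUP n. h n x)" for x
  show thesis
  proof
    show "g \<in> borel_measurable M" unfolding g_def using hM by measurable
    show "0 \<le> g x" for x by (simp add: g_def)
    fix n
    have "AE x in completion (N n). f x \<noteq> \<infinity>"
      using fin[of n] by (intro nn_integral_noteq_infinite f) auto
    then have "AE x in N n. f x \<noteq> \<infinity>"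
      by (simp only: AE_completion_iff)
    with h(3) show "AE x in N n. f x = ennreal (g x)"
    proof eventually_elim
      case (elim x)
      \<comment> \<open>At such a point one of the \<open>h n\<close> already attains the upper
        bound \<open>f x\<close>.\<close>
      have "f x \<le> (SUP n. h n x)" by (metis SUP_upper UNIV_I elim(1))
      moreover have "(SUP n. h n x) \<le> f x" using h(2) by (auto intro: SUP_least simp: le_fun_def)
      ultimately have "(SUP n. h n x) = f x" by (rule antisym[rotated])
      then show ?case using elim by (simp add: g_def less_top)
    qed
  qed
qed

text \<open>The sum counts the positive multiples of \<open>c\<close> up to \<open>t\<close>. Since
  \<open>t \<le> real N * c\<close>, none is missed, so the sum is the floor of
  \<open>t / c\<close>, and rounding \<open>t\<close> down to a multiple of \<open>c\<close> costs
  at most \<open>c\<close>.\<close>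

lemma level_set_approximation:
  fixes t c :: real
  assumes "0 < c" "0 \<le> t" "t \<le> real N * c"
  shows "\<bar>t - c * (\<Sum>j=1..N. indicator {s. real j * c \<le> s} t)\<bar> \<le> c"
proof -
  define p where "p = nat \<lfloor>t / c\<rfloor>"
  have "0 \<le> t / c" using assms by simp
  then have p: "real p \<le> t / c" "t / c < real p + 1"
    unfolding p_def by linarith+
  have "t / c \<le> real N" using assms by (simp add: pos_divide_le_eq)
  then have "p \<le> N" using p(1) by linarith
  have iff: "real j * c \<le> t \<longleftrightarrow> j \<le> p" for j
  proof -
    have "real j * c \<le> t \<longleftrightarrow> real j \<le> t / c" using assms(1) by (rule pos_le_divide_eq[symmetric])
    then show ?thesis using p by linarith
  qed
  have "(\<Sum>j=1..N. indicator {s. real j * c \<le> s} t) = (\<Sum>j=1..N. if j \<in> {1..p} then 1 else (0::real))"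
    by (intro sum.cong) (auto simp: indicator_def iff)
  also have "\<dots> = real p"
    using \<open>p \<le> N\<close> by (subst sum.inter_restrict[symmetric]) (auto simp: Int_absorb1)
  finally have "(\<Sum>j=1..N. indicator {s. real j * c \<le> s} t) = real p" .
  then show ?thesis using p assms(1) by (simp add: field_simps abs_le_iff)
qed

text \<open>Total mass one turns the pointwise error \<open>c\<close> into the same error for
  integrals. The bound depends on neither \<open>U\<close> nor the measure, which later allows both
  to vary with \<open>n\<close>.\<close>

lemma (in prob_space) integral_level_set_approximation:
  fixes h :: "'a \<Rightarrow> real"
  assumes h: "h \<in> borel_measurable M" "\<And>x. 0 \<le> h x" "\<And>x. h x \<le> real N * c"
    and c: "0 < c" and U: "U \<in> events"
  shows "\<bar>(\<integral>x. indicator U x * h x \<partial>M) - c * (\<Sum>j=1..N. prob (U \<inter> {x\<in>space M. real j * c \<le> h x}))\<bar> \<le> c"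
proof -
  let ?A = "\<lambda>j. U \<inter> {x\<in>space M. real j * c \<le> h x}"
  have A: "?A j \<in> events" for j using h(1) U by measurable
  have int: "integrable M (\<lambda>x. indicator U x * h x)"
    using h U c by (intro integrable_const_bound[where B = "real N * c"] AE_I2)
      (auto simp: indicator_def)
  have int_A: "integrable M (indicator (?A j) :: 'a \<Rightarrow> real)" for j
    using A[of j] by (simp add: emeasure_finite less_top[symmetric])
  have eq: "c * (\<Sum>j=1..N. prob (?A j)) = (\<integral>x. c * (\<Sum>j=1..N. indicator (?A j) x) \<partial>M)"
    using int_A A by (simp add: Bochner_Integration.integral_sum del: sum_mult_indicator)
  have int2: "integrable M (\<lambda>x. c * (\<Sum>j=1..N. indicator (?A j) x))"
    using int_A by simp
  have "\<bar>(\<integral>x. indicator U x * h x \<partial>M) - c * (\<Sum>j=1..N. prob (?A j))\<bar>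
      = \<bar>\<integral>x. (indicator U x * h x - c * (\<Sum>j=1..N. indicator (?A j) x)) \<partial>M\<bar>"
    unfolding eq using int int2 by simp
  also have "\<dots> \<le> (\<integral>x. \<bar>indicator U x * h x - c * (\<Sum>j=1..N. indicator (?A j) x)\<bar> \<partial>M)"
    by (rule integral_abs_bound)
  also have "\<dots> \<le> (\<integral>x. c \<partial>M)"
  proof (intro integral_mono)
    show "integrable M (\<lambda>x. \<bar>indicator U x * h x - c * (\<Sum>j=1..N. indicator (?A j) x)\<bar>)"
      using int int2 by simp
    fix x assume x: "x \<in> space M"
    show "\<bar>indicator U x * h x - c * (\<Sum>j=1..N. indicator (?A j) x)\<bar> \<le> c"
    \<comment> \<open>Outside \<open>U\<close> the integrand and all the indicators vanish, leaving
      \<open>0 \<le> c\<close>.\<close>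
    proof (cases "x \<in> U")
      case True
      then have "(\<Sum>j=1..N. indicator (?A j) x) = (\<Sum>j=1..N. indicator {s. real j * c \<le> s} (h x) :: real)"
        using x by (intro sum.cong) (auto simp: indicator_def)
      then show ?thesis using True level_set_approximation[OF c h(2,3)] by simp
    qed (use c in simp)
  qed simp
  finally show ?thesis by (simp add: prob_space)
qed

text \<open>A fixed mesh gives finitely many level sets, the same for all \<open>n\<close>; applying
  \<open>conv\<close> to each of them controls the difference of the sums.\<close>

lemma bounded_integral_diff_tendsto_0:
  fixes h :: "'a \<Rightarrow> real"
  assumes M: "prob_space M" and N: "\<And>n. prob_space (N n)" and sets: "\<And>n. sets (N n) = sets M"
    and h: "h \<in> borel_measurable M" "\<And>x. 0 \<le> h x" "\<And>x. h x \<le> B"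
    and U: "\<And>n. U n \<in> sets M"
    and conv: "\<And>A. A \<in> sets M \<Longrightarrow> (\<lambda>n. measure (N n) (U n \<inter> A) - measure M (U n \<inter> A)) \<longlonglongrightarrow> 0"
  shows "(\<lambda>n. (\<integral>x. indicator (U n) x * h x \<partial>N n) - (\<integral>x. indicator (U n) x * h x \<partial>M)) \<longlonglongrightarrow> 0"
proof (rule LIMSEQ_I)
  fix e :: real assume "0 < e"
  \<comment> \<open>One third for the approximation error under each of the two measures, one for
    the difference of the sums.\<close>
  define c where "c = e / 3"
  have c: "0 < c" using \<open>0 < e\<close> by (simp add: c_def)
  obtain K :: nat where "B / c \<le> real K" using real_arch_simple by blast
  then have hK: "\<And>x. h x \<le> real K * c" using h(3) c by (force simp: field_simps intro: order_trans)
  let ?A = "\<lambda>j. {x\<in>space M. real j * c \<le> h x}"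
  have A: "?A j \<in> sets M" for j using h(1) by measurable
  have space: "space (N n) = space M" for n using sets by (rule sets_eq_imp_space_eq)
  have hN: "h \<in> borel_measurable (N n)" for n
    using h(1) measurable_cong_sets[OF sets refl] by blast
  let ?s = "\<lambda>m n. c * (\<Sum>j=1..K. measure m (U n \<inter> ?A j))"
  have 1: "\<bar>(\<integral>x. indicator (U n) x * h x \<partial>M) - ?s M n\<bar> \<le> c" for n
    using prob_space.integral_level_set_approximation[OF M h(1,2) hK c U] by blast
  have 2: "\<bar>(\<integral>x. indicator (U n) x * h x \<partial>N n) - ?s (N n) n\<bar> \<le> c" for n
    using prob_space.integral_level_set_approximation[OF N hN h(2) hK c, of "U n"] U sets space by simp
  have e: "e = c + c + c" by (simp add: c_def)
  have "(\<lambda>n. c * (\<Sum>j=1..K. measure (N n) (U n \<inter> ?A j) - measure M (U n \<inter> ?A j))) \<longlonglongrightarrow> c * (\<Sum>j=1..K. 0)"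
    by (intro tendsto_intros conv A)
  then have "(\<lambda>n. ?s (N n) n - ?s M n) \<longlonglongrightarrow> 0"
    by (simp add: sum_subtractf right_diff_distrib)
  from LIMSEQ_D[OF this c]
  obtain n0 where n0: "\<And>n. n \<ge> n0 \<Longrightarrow> \<bar>?s (N n) n - ?s M n\<bar> < c"
    by auto
  have "\<bar>(\<integral>x. indicator (U n) x * h x \<partial>N n) - (\<integral>x. indicator (U n) x * h x \<partial>M)\<bar> < e" if "n \<ge> n0" for n
    using 1[of n] 2[of n] n0[OF that] unfolding e by linarith
  then show "\<exists>n0. \<forall>n\<ge>n0. norm ((\<integral>x. indicator (U n) x * h x \<partial>N n) - (\<integral>x. indicator (U n) x * h x \<partial>M) - 0) < e"
    by auto
qed

text \<open>The bounded case applies to \<open>g\<close> cut off at a height \<open>k\<close>;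
  \<open>k\<close> is chosen so that the part removed has small integral under \<open>M\<close> and
  under all \<open>N n\<close> simultaneously.\<close>

lemma integral_diff_tendsto_0:
  fixes g :: "'a \<Rightarrow> real"
  assumes M: "prob_space M" and N: "\<And>n. prob_space (N n)" and sets: "\<And>n. sets (N n) = sets M"
    and g: "integrable M g" "\<And>n. integrable (N n) g" "\<And>x. 0 \<le> g x"
    and tail: "\<And>e. 0 < e \<Longrightarrow> \<exists>k0. \<forall>k\<ge>k0. \<forall>n. (\<integral>x. indicator {x\<in>space M. real k < g x} x * g x \<partial>N n) \<le> e"
    and U: "\<And>n. U n \<in> sets M"
    and conv: "\<And>A. A \<in> sets M \<Longrightarrow> (\<lambda>n. measure (N n) (U n \<inter> A) - measure M (U n \<inter> A)) \<longlonglongrightarrow> 0"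
  shows "(\<lambda>n. (\<integral>x. indicator (U n) x * g x \<partial>N n) - (\<integral>x. indicator (U n) x * g x \<partial>M)) \<longlonglongrightarrow> 0"
proof (rule LIMSEQ_I)
  fix e :: real assume "0 < e"
  then have e: "0 < e / 3" by simp
  let ?T = "\<lambda>k. {x\<in>space M. real k < g x}"
  have gM: "g \<in> borel_measurable M" using g(1) by simp
  have T: "?T k \<in> sets M" for k using gM by measurable
  \<comment> \<open>The hypothesis \<open>tail\<close> concerns only the \<open>N n\<close>; under
    \<open>M\<close> the tails vanish by dominated convergence with \<open>g\<close> itself as
    majorant.\<close>
  have "(\<lambda>k. \<integral>x. indicator (?T k) x * g x \<partial>M) \<longlonglongrightarrow> (\<integral>x. 0 \<partial>M)"
  proof (rule integral_dominated_convergence[where w = g])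
    show "AE x in M. (\<lambda>k. indicator (?T k) x * g x) \<longlonglongrightarrow> 0"
    proof (rule AE_I2)
      fix x
      obtain K :: nat where "g x \<le> real K" using real_arch_simple by blast
      then have "\<forall>\<^sub>F k in sequentially. indicator (?T k) x * g x = 0"
        by (intro eventually_sequentiallyI[of K]) (auto simp: indicator_def)
      then show "(\<lambda>k. indicator (?T k) x * g x) \<longlonglongrightarrow> 0" by (rule tendsto_eventually)
    qed
  qed (use g gM T in \<open>auto simp: indicator_def\<close>)
  from LIMSEQ_D[OF this e]
  obtain k1 where k1: "\<And>k. k \<ge> k1 \<Longrightarrow> \<bar>\<integral>x. indicator (?T k) x * g x \<partial>M\<bar> < e / 3"
    by auto
  obtain k0 where k0: "\<And>k n. k \<ge> k0 \<Longrightarrow> (\<integral>x. indicator (?T k) x * g x \<partial>N n) \<le> e / 3"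
    using tail[OF e] by blast
  define k where "k = max k0 k1"
  \<comment> \<open>Cutting to zero above \<open>k\<close>, rather than capping at \<open>k\<close>,
    makes \<open>g - h\<close> on the space exactly the tail integrand bounded above.\<close>
  define h where "h x = indicator (- ?T k \<inter> space M) x * g x" for x
  have hM: "h \<in> borel_measurable M" unfolding h_def using T[of k] gM by measurable
  \<comment> \<open>Stated for an arbitrary measure \<open>m\<close>, to be used for
    \<open>M\<close> and for each \<open>N n\<close>.\<close>
  have cut: "(\<integral>x. indicator V x * h x \<partial>m) \<le> (\<integral>x. indicator V x * g x \<partial>m) \<and>
      (\<integral>x. indicator V x * g x \<partial>m) \<le> (\<integral>x. indicator V x * h x \<partial>m) + (\<integral>x. indicator (?T k) x * g x \<partial>m)"
    if m: "sets m = sets M" "integrable m g" and V: "V \<in> sets M" for m V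
  proof -
    have sp: "space m = space M" using m(1) by (rule sets_eq_imp_space_eq)
    have i: "integrable m (\<lambda>x. indicator W x * g x)" if "W \<in> sets M" for W
      using integrable_mult_indicator[of W m g] that m by simp
    have ih: "integrable m (\<lambda>x. indicator V x * h x)"
      using i[of "V \<inter> (space M - ?T k)"] V T[of k]
      by (auto simp: h_def indicator_inter_arith mult.assoc Int_commute Diff_eq)
    have "(\<integral>x. indicator V x * h x \<partial>m) \<le> (\<integral>x. indicator V x * g x \<partial>m)"
      using g(3) by (intro integral_mono ih i V) (auto simp: h_def indicator_def)
    moreover have "(\<integral>x. indicator V x * g x \<partial>m) \<le> (\<integral>x. indicator V x * h x + indicator (?T k) x * g x \<partial>m)"
      using g(3) by (intro integral_mono Bochner_Integration.integrable_add ih i V T)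
        (auto simp: h_def indicator_def sp)
    ultimately show ?thesis using ih i[OF T] by simp
  qed
  have "(\<lambda>n. (\<integral>x. indicator (U n) x * h x \<partial>N n) - (\<integral>x. indicator (U n) x * h x \<partial>M)) \<longlonglongrightarrow> 0"
    by (rule bounded_integral_diff_tendsto_0[OF M N sets hM _ _ U conv, where B = "real k"])
      (use g(3) in \<open>auto simp: h_def indicator_def\<close>)
  from LIMSEQ_D[OF this e] obtain n0 where n0: "\<And>n. n \<ge> n0 \<Longrightarrow>
      \<bar>(\<integral>x. indicator (U n) x * h x \<partial>N n) - (\<integral>x. indicator (U n) x * h x \<partial>M)\<bar> < e / 3"
    by auto
  \<comment> \<open>Since \<open>g\<close> is nonnegative, each one-sided estimate involves only one
    of the two tails.\<close>
  have "\<bar>(\<integral>x. indicator (U n) x * g x \<partial>N n) - (\<integral>x. indicator (U n) x * g x \<partial>M)\<bar> < e" if "n \<ge> n0" for n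
    using cut[OF sets g(2) U, of n n] cut[OF refl g(1) U, of n] n0[OF that] k0[of k n] k1[of k]
    unfolding k_def by linarith
  then show "\<exists>n0. \<forall>n\<ge>n0. norm ((\<integral>x. indicator (U n) x * g x \<partial>N n) - (\<integral>x. indicator (U n) x * g x \<partial>M) - 0) < e"
    by auto
qed

lemma converges_setwise_iff_diff:
  "converges_setwise \<F> m m' \<longleftrightarrow> (\<forall>U\<in>\<F>. (\<lambda>n. m n U - m' U) \<longlonglongrightarrow> 0)"
  unfolding converges_setwise_def by (simp add: LIM_zero_iff)

text \<open>Uniform convergence over a family can be tested along one member per index, chosen to
  violate a given bound whenever some member does. This reduces variation to the argument for
  setwise convergence, with sets depending on \<open>n\<close>.\<close>

lemma converges_in_variation_iff_sequences:
  assumes "\<F> \<noteq> {}"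
  shows "converges_in_variation \<F> m m' \<longleftrightarrow> (\<forall>U. range U \<subseteq> \<F> \<longrightarrow> (\<lambda>n. m n (U n) - m' (U n)) \<longlonglongrightarrow> 0)"
proof (intro iffI allI impI)
  fix U :: "nat \<Rightarrow> 'a set"
  assume "converges_in_variation \<F> m m'" and U: "range U \<subseteq> \<F>"
  then have lim: "(\<lambda>n. SUP U\<in>\<F>. ennreal \<bar>m n U - m' U\<bar>) \<longlonglongrightarrow> 0"
    by (simp add: converges_in_variation_def)
  have upper: "ennreal \<bar>m n (U n) - m' (U n)\<bar> \<le> (SUP U\<in>\<F>. ennreal \<bar>m n U - m' U\<bar>)" for n
    using U by (intro SUP_upper) auto
  have "(\<lambda>n. ennreal \<bar>m n (U n) - m' (U n)\<bar>) \<longlonglongrightarrow> ennreal 0"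
    unfolding ennreal_0
    by (rule tendsto_sandwich[OF always_eventually always_eventually tendsto_const lim])
      (use upper in simp_all)
  then have "(\<lambda>n. \<bar>m n (U n) - m' (U n)\<bar>) \<longlonglongrightarrow> 0" by (subst (asm) tendsto_ennreal_iff) auto
  then show "(\<lambda>n. m n (U n) - m' (U n)) \<longlonglongrightarrow> 0" by (rule tendsto_rabs_zero_cancel)
next
  assume *: "\<forall>U. range U \<subseteq> \<F> \<longrightarrow> (\<lambda>n. m n (U n) - m' (U n)) \<longlonglongrightarrow> 0"
  have bound: "\<forall>\<^sub>F n in sequentially. (SUP U\<in>\<F>. ennreal \<bar>m n U - m' U\<bar>) \<le> ennreal e" if "0 < e" for e
  proof -
    \<comment> \<open>If no member violates the bound at \<open>n\<close>, any member serves; this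
      is where the family must be nonempty.\<close>
    have "\<forall>n. \<exists>V. V \<in> \<F> \<and> ((\<exists>W\<in>\<F>. e \<le> \<bar>m n W - m' W\<bar>) \<longrightarrow> e \<le> \<bar>m n V - m' V\<bar>)"
      using assms by blast
    then obtain U where U: "\<And>n. U n \<in> \<F>"
      "\<And>n W. W \<in> \<F> \<Longrightarrow> e \<le> \<bar>m n W - m' W\<bar> \<Longrightarrow> e \<le> \<bar>m n (U n) - m' (U n)\<bar>"
      by metis
    then have "(\<lambda>n. m n (U n) - m' (U n)) \<longlonglongrightarrow> 0" using * by blast
    then have "\<forall>\<^sub>F n in sequentially. \<bar>m n (U n) - m' (U n)\<bar> < e"
      using that by (auto simp: tendsto_iff)
    then show ?thesis
    proof eventually_elim
      case (elim n)
      show ?case using U(2)[of _ n] elim by (intro SUP_least ennreal_leI) force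
    qed
  qed
  show "converges_in_variation \<F> m m'"
    unfolding converges_in_variation_def
  proof (rule order_tendstoI)
    fix a :: ennreal assume "0 < a"
    \<comment> \<open>The intermediate \<open>b\<close> is finite even if \<open>a\<close> is
      infinite, and makes the final inequality strict.\<close>
    then obtain b where b: "0 < b" "b < a" using dense by blast
    then obtain r where "b = ennreal r" "0 < r" by (cases b) (auto simp: ennreal_less_zero_iff)
    then show "\<forall>\<^sub>F n in sequentially. (SUP U\<in>\<F>. ennreal \<bar>m n U - m' U\<bar>) < a"
      using bound[of r] b(2) by (auto elim: eventually_mono)
  qed auto
qed

text \<open>Passes from \<open>ennreal\<close> integrals over a completion to real integrals of the
  Borel version. The two conditions from \<open>M0\<close> enter separately: finiteness gives
  integrability, positivity makes the quotient a genuine real division.\<close>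

lemma (in prob_space) posterior_eq_integral:
  fixes g :: "'b::topological_space \<Rightarrow> real"
  assumes Z: "Z \<in> borel_measurable M" and g: "g \<in> borel_measurable borel" "\<And>x. 0 \<le> g x"
    and eq: "AE x in law M Z. \<rho> x y = ennreal (g x)"
    and pos: "0 < (\<integral>\<^sup>+x. \<rho> x y \<partial>completion (law M Z))"
    and fin: "(\<integral>\<^sup>+x. \<rho> x y \<partial>completion (law M Z)) < \<infinity>"
  shows "integrable (law M Z) g" and "0 < (\<integral>x. g x \<partial>law M Z)"
    and "U \<in> sets borel \<Longrightarrow>
      unnormalized_posterior M \<rho> Z U y = ennreal (\<integral>x. indicator U x * g x \<partial>law M Z)"
    and "U \<in> sets borel \<Longrightarrow>
      posterior M \<rho> Z U y = (\<integral>x. indicator U x * g x \<partial>law M Z) / (\<integral>x. g x \<partial>law M Z)"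
proof -
  have total: "(\<integral>\<^sup>+x. \<rho> x y \<partial>completion (law M Z)) = (\<integral>\<^sup>+x. ennreal (g x) \<partial>law M Z)"
    unfolding nn_integral_completion using eq by (rule nn_integral_cong_AE)
  show int: "integrable (law M Z) g"
    using g fin unfolding total by (intro integrableI_nonneg) auto
  have total': "(\<integral>\<^sup>+x. \<rho> x y \<partial>completion (law M Z)) = ennreal (\<integral>x. g x \<partial>law M Z)"
    unfolding total using int g(2) by (intro nn_integral_eq_integral) auto
  show pos': "0 < (\<integral>x. g x \<partial>law M Z)"
    using pos unfolding total' by simp
  assume U: "U \<in> sets borel"
  have intU: "integrable (law M Z) (\<lambda>x. indicator U x * g x)"
    using integrable_mult_indicator[of U "law M Z" g] U int by simp
  have "unnormalized_posterior M \<rho> Z U y = (\<integral>\<^sup>+x. ennreal (indicator U x * g x) \<partial>law M Z)"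
    unfolding unnormalized_posterior_def nn_integral_completion
    using eq by (intro nn_integral_cong_AE) (auto elim!: eventually_mono simp: indicator_def)
  also have "\<dots> = ennreal (\<integral>x. indicator U x * g x \<partial>law M Z)"
    using intU g(2) by (intro nn_integral_eq_integral) auto
  finally show un: "unnormalized_posterior M \<rho> Z U y = ennreal (\<integral>x. indicator U x * g x \<partial>law M Z)" .
  have "0 \<le> (\<integral>x. indicator U x * g x \<partial>law M Z)" using g(2) by simp
  then show "posterior M \<rho> Z U y = (\<integral>x. indicator U x * g x \<partial>law M Z) / (\<integral>x. g x \<partial>law M Z)"
    unfolding posterior_def un total' using pos' by (simp add: divide_ennreal)
qed

theorem theorem4p7:
  fixes P :: "'w measure"
    and X :: "'w \<Rightarrow> 'f::locally_convex_space"
    and Xn :: "nat \<Rightarrow> 'w \<Rightarrow> 'f"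
    and \<epsilon> :: "'w \<Rightarrow> 'g::locally_convex_space"
    and L :: "'f \<Rightarrow> 'g"
    and Y :: "'w \<Rightarrow> 'g"
    and Yn :: "nat \<Rightarrow> 'w \<Rightarrow> 'g"
    and \<nu> :: "'g measure"
    and \<rho> :: "'f \<Rightarrow> 'g \<Rightarrow> ennreal"
    and y :: 'g
  assumes "inverse_problem P X Xn \<epsilon> L Y Yn \<nu> \<rho>"
    and "y \<in> M0 P X Xn \<rho>"
    and uniformly_bounded:
      "\<exists>C::real. \<forall>n. \<forall>U\<in>sets borel. unnormalized_posterior P \<rho> (Xn n) U y \<le> ennreal C"
    and equicontinuous_at_zero:
      "\<And>U :: nat \<Rightarrow> 'f set. range U \<subseteq> sets borel \<Longrightarrow> decseq U \<Longrightarrow> (\<Inter>i. U i) = {} \<Longrightarrow>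
         (\<lambda>i. SUP n. unnormalized_posterior P \<rho> (Xn n) (U i) y) \<longlonglongrightarrow> 0"
  shows "(converges_setwise (sets borel) (\<lambda>n. measure (law P (Xn n))) (measure (law P X)) \<longrightarrow>
          converges_setwise (sets borel) (\<lambda>n U. posterior P \<rho> (Xn n) U y) (\<lambda>U. posterior P \<rho> X U y))
       \<and> (converges_in_variation (sets borel) (\<lambda>n. measure (law P (Xn n))) (measure (law P X)) \<longrightarrow>
          converges_in_variation (sets borel) (\<lambda>n U. posterior P \<rho> (Xn n) U y) (\<lambda>U. posterior P \<rho> X U y))"
proof -
  interpret inverse_problem P X Xn \<epsilon> L Y Yn \<nu> \<rho> by fact
  let ?M = "law P X" and ?N = "\<lambda>n. law P (Xn n)"
  \<comment> \<open>All priors are listed in one sequence, the limit first, so that a single version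
    \<open>g\<close> serves them all.\<close>
  define Zs where "Zs k = (case k of 0 \<Rightarrow> X | Suc n \<Rightarrow> Xn n)" for k
  have Zs_simps: "Zs 0 = X" "\<And>n. Zs (Suc n) = Xn n" by (simp_all add: Zs_def)
  have range_Zs: "range Zs = insert X (range Xn)"
    by (force simp: Zs_def image_iff split: nat.splits)
  have M0: "(\<lambda>x. \<rho> x y) \<in> borel_measurable (completion (law P Z))"
    "0 < (\<integral>\<^sup>+x. \<rho> x y \<partial>completion (law P Z))" "(\<integral>\<^sup>+x. \<rho> x y \<partial>completion (law P Z)) < \<infinity>"
    if "Z \<in> insert X (range Xn)" for Z
    using assms(2) that unfolding M0_def by blast+
  obtain g :: "'f \<Rightarrow> real" where g: "g \<in> borel_measurable borel" "\<And>x. 0 \<le> g x"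
    and g_Zs: "\<And>k. AE x in law P (Zs k). \<rho> x y = ennreal (g x)"
  proof (rule common_borel_version[of "\<lambda>k. law P (Zs k)" borel "\<lambda>x. \<rho> x y"])
    have "Zs k \<in> insert X (range Xn)" for k using range_Zs by blast
    then show "(\<lambda>x. \<rho> x y) \<in> borel_measurable (completion (law P (Zs k)))"
      "(\<integral>\<^sup>+x. \<rho> x y \<partial>completion (law P (Zs k))) < \<infinity>" for k
      using M0(1,3) by blast+
  qed auto
  have gX: "AE x in ?M. \<rho> x y = ennreal (g x)" using g_Zs[of 0] unfolding Zs_simps .
  have gN: "AE x in ?N n. \<rho> x y = ennreal (g x)" for n using g_Zs[of "Suc n"] unfolding Zs_simps .
  note X = posterior_eq_integral[where \<rho> = \<rho> and y = y, OF X_measurable g gX M0(2,3)[OF insertI1]]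
  note N = posterior_eq_integral[where \<rho> = \<rho> and y = y, OF Xn_measurable g gN M0(2,3)[OF insertI2[OF rangeI]]]
  define a where "a U = (\<integral>x. indicator U x * g x \<partial>?M)" for U
  define an where "an n U = (\<integral>x. indicator U x * g x \<partial>?N n)" for n U
  define b where "b = (\<integral>x. g x \<partial>?M)"
  define bn where "bn n = (\<integral>x. g x \<partial>?N n)" for n

  \<comment> \<open>The superlevel sets of \<open>g\<close> decrease to the empty set because
    \<open>g\<close> is real-valued, so equicontinuity at zero applies to them.\<close>
  have tail: "\<exists>k0. \<forall>k\<ge>k0. \<forall>n. an n {x\<in>space ?M. real k < g x} \<le> e" if "0 < e" for e
  proof -
    let ?T = "\<lambda>k. {x. real k < g x}"
    have T: "?T k \<in> sets borel" for k using g(1) by measurable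
    have "(\<Inter>k. ?T k) = {}"
    proof safe
      fix x assume "x \<in> (\<Inter>k. ?T k)"
      moreover obtain k :: nat where "g x \<le> real k" using real_arch_simple by blast
      ultimately show "x \<in> {}" by (auto simp: not_less[symmetric])
    qed
    moreover have "decseq ?T" by (force simp: decseq_def)
    ultimately have "(\<lambda>k. SUP n. unnormalized_posterior P \<rho> (Xn n) (?T k) y) \<longlonglongrightarrow> 0"
      using T by (intro equicontinuous_at_zero) auto
    then have "\<forall>\<^sub>F k in sequentially. (SUP n. unnormalized_posterior P \<rho> (Xn n) (?T k) y) < ennreal e"
      using that by (intro order_tendstoD) auto
    then obtain k0 where k0: "\<And>k. k \<ge> k0 \<Longrightarrow> (SUP n. unnormalized_posterior P \<rho> (Xn n) (?T k) y) < ennreal e"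
      by (auto simp: eventually_sequentially)
    have "an n (?T k) \<le> e" if "k \<ge> k0" for k n
    proof -
      have "ennreal (an n (?T k)) < ennreal e"
        using le_less_trans[OF SUP_upper k0[OF that], of n] unfolding N(3)[OF T] an_def by simp
      then show ?thesis using \<open>0 < e\<close> by (simp add: ennreal_less_iff an_def g(2))
    qed
    then show ?thesis by auto
  qed

  have diff: "(\<lambda>n. an n (U n) - a (U n)) \<longlonglongrightarrow> 0"
    if U: "\<And>n. U n \<in> sets borel"
      and conv: "\<And>A. A \<in> sets borel \<Longrightarrow> (\<lambda>n. measure (?N n) (U n \<inter> A) - measure ?M (U n \<inter> A)) \<longlonglongrightarrow> 0"
    for U
    unfolding a_def an_def
    by (rule integral_diff_tendsto_0[OF _ _ _ X(1) N(1) g(2) tail[unfolded an_def]])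
      (use U conv X_measurable Xn_measurable in \<open>auto intro: prob_space_distr\<close>)

  \<comment> \<open>\<open>conv\<close> serves the numerators, \<open>conv'\<close> the normalizing
    constants, which are the case of the constant sequence \<open>UNIV\<close>.\<close>
  have posterior_diff: "(\<lambda>n. posterior P \<rho> (Xn n) (U n) y - posterior P \<rho> X (U n) y) \<longlonglongrightarrow> 0"
    if U: "\<And>n. U n \<in> sets borel"
      and conv: "\<And>A. A \<in> sets borel \<Longrightarrow> (\<lambda>n. measure (?N n) (U n \<inter> A) - measure ?M (U n \<inter> A)) \<longlonglongrightarrow> 0"
      and conv': "\<And>A. A \<in> sets borel \<Longrightarrow> (\<lambda>n. measure (?N n) A - measure ?M A) \<longlonglongrightarrow> 0"
    for U
  proof -
    have b: "0 < b" unfolding b_def by (rule X(2))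
    have bn: "0 < bn n" for n unfolding bn_def by (rule N(2))
    have "(\<lambda>n. bn n - b) \<longlonglongrightarrow> 0"
      using diff[of "\<lambda>_. UNIV"] conv' by (simp add: a_def an_def b_def bn_def)
    then have bn_lim: "bn \<longlonglongrightarrow> b" by (rule LIM_zero_cancel)
    \<comment> \<open>The values \<open>a (U n)\<close> need not converge when the sets vary;
      boundedness suffices, as they are multiplied by a null sequence.\<close>
    have a_bound: "0 \<le> a (U n) \<and> a (U n) \<le> b" for n
      unfolding a_def b_def using g(2) U X(1) integrable_mult_indicator[of "U n" ?M g]
      by (auto intro!: integral_mono simp: indicator_def)
    have "(\<lambda>n. 1 / bn n - 1 / b) \<longlonglongrightarrow> 1 / b - 1 / b"
      using b by (intro tendsto_intros bn_lim) auto
    then have "Zfun (\<lambda>n. 1 / bn n - 1 / b) sequentially" by (simp add: tendsto_Zfun_iff)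
    moreover have "Bfun (\<lambda>n. a (U n)) sequentially"
      using a_bound by (intro BfunI[where K = b] always_eventually) auto
    ultimately have "(\<lambda>n. a (U n) * (1 / bn n - 1 / b)) \<longlonglongrightarrow> 0"
      by (simp add: tendsto_Zfun_iff bounded_bilinear.Bfun_prod_Zfun[OF bounded_bilinear_mult])
    moreover have "(\<lambda>n. (an n (U n) - a (U n)) / bn n) \<longlonglongrightarrow> 0 / b"
      using b by (intro tendsto_divide diff U conv bn_lim) auto
    \<comment> \<open>The difference of the quotients \<open>an n (U n) / bn n\<close> and
      \<open>a (U n) / b\<close>, split into a change of numerator and a change of
      denominator.\<close>
    ultimately have "(\<lambda>n. (an n (U n) - a (U n)) / bn n + a (U n) * (1 / bn n - 1 / b)) \<longlonglongrightarrow> 0 / b + 0"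
      by (rule tendsto_add[rotated])
    then show ?thesis
      unfolding X(4)[OF U] N(4)[OF U] a_def[symmetric] an_def[symmetric] b_def[symmetric] bn_def[symmetric]
      by (simp add: diff_divide_distrib right_diff_distrib)
  qed

  show ?thesis
  proof (intro conjI impI)
    assume "converges_setwise (sets borel) (\<lambda>n. measure (?N n)) (measure ?M)"
    then have "(\<lambda>n. measure (?N n) A - measure ?M A) \<longlonglongrightarrow> 0" if "A \<in> sets borel" for A
      using that by (auto simp: converges_setwise_iff_diff)
    then show "converges_setwise (sets borel) (\<lambda>n U. posterior P \<rho> (Xn n) U y) (\<lambda>U. posterior P \<rho> X U y)"
      unfolding converges_setwise_iff_diff by (intro ballI posterior_diff) auto
  next
    assume "converges_in_variation (sets borel) (\<lambda>n. measure (?N n)) (measure ?M)"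
    then have *: "(\<lambda>n. measure (?N n) (U n) - measure ?M (U n)) \<longlonglongrightarrow> 0"
      if "range U \<subseteq> sets borel" for U
      using that by (subst (asm) converges_in_variation_iff_sequences) auto
    show "converges_in_variation (sets borel) (\<lambda>n U. posterior P \<rho> (Xn n) U y) (\<lambda>U. posterior P \<rho> X U y)"
    proof (subst converges_in_variation_iff_sequences, force, intro allI impI)
      \<comment> \<open>The sets \<open>U n \<inter> A\<close> again form a sequence of Borel sets,
        and constant sequences yield the condition on a fixed \<open>A\<close>.\<close>
      fix U :: "nat \<Rightarrow> 'f set" assume "range U \<subseteq> sets borel"
      then show "(\<lambda>n. posterior P \<rho> (Xn n) (U n) y - posterior P \<rho> X (U n) y) \<longlonglongrightarrow> 0"
        by (intro posterior_diff *) auto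
    qed
  qed
qed

end
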